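(* There is a universal constant $c>0$ such that for every $n\ge 1$ and every nonconstant Boolean function $f:\{-1,1\}^n\to\{-1,1\}$, $$\mathsf B(f)\ \ge\ c\,\operatorname{Var}(f)\sqrt{\log\!\left(1+\frac1{M(f)}\right)},\qquad M(f)=\sum_{i=1}^n \operatorname{Inf}_i(f)^2 .$$
   Context: $\{-1,1\}^n$ carries the uniform probability measure; $\mathbb E$, $\Pr$, $\operatorname{Var}$ refer to it. $x^{\oplus i}$ is $x$ with the $i$th coordinate flipped. For $g:\{-1,1\}^n\to\mathbb R$, $D_ig(x)=\frac{g(x)-g(x^{\oplus i})}2$ and $L=\sum_{i=1}^n D_i$. $\operatorname{Inf}_i(f)=\Pr[f(x)\ne f(x^{\oplus i})]$. A vector field is a map $V=(V_1,\dots,V_n):\{-1,1\}^n\to\mathbb R^n$, with divergence $\operatorname{div}V(x)=\sum_{i=1}^n\big(V_i(x)-V_i(x^{\oplus i})\big)$. The Beckmann boundary of $f$ is $$\mathsf B(f)=\inf\{\mathbb E\|V(x)\|_2:\ V \text{ a vector field with } \operatorname{div}V=Lf\},$$ where $\|\cdot\|_2$ is the Euclidean norm on $\mathbb R^n$. *)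

theory Defs
  imports "HOL-Probability.Probability"
begin

text \<open>
  The dimension \<open>n\<close> is a term rather than a type, because the constant in the theorem must be
  chosen before \<open>n\<close>. Points of the cube are extensional functions on the coordinate set
  \<open>{..<n}\<close>, so that they correspond bijectively to sign vectors of length \<open>n\<close> and the set
  is finite; coordinates are numbered from 0.
\<close>

definition cube :: "nat \<Rightarrow> (nat \<Rightarrow> real) set" where
  "cube n = (\<Pi>\<^sub>E i\<in>{..<n}. {-1, 1})"

abbreviation cube_pmf :: "nat \<Rightarrow> (nat \<Rightarrow> real) pmf" where
  "cube_pmf n \<equiv> pmf_of_set (cube n)"

definition flip :: "nat \<Rightarrow> (nat \<Rightarrow> real) \<Rightarrow> (nat \<Rightarrow> real)" where
  "flip i x = x(i := - x i)"

definition cube_deriv :: "nat \<Rightarrow> ((nat \<Rightarrow> real) \<Rightarrow> real) \<Rightarrow> (nat \<Rightarrow> real) \<Rightarrow> real" where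
  "cube_deriv i g x = (g x - g (flip i x)) / 2"

definition laplacian :: "nat \<Rightarrow> ((nat \<Rightarrow> real) \<Rightarrow> real) \<Rightarrow> (nat \<Rightarrow> real) \<Rightarrow> real" where
  "laplacian n g x = (\<Sum>i<n. cube_deriv i g x)"

definition influence :: "nat \<Rightarrow> nat \<Rightarrow> ((nat \<Rightarrow> real) \<Rightarrow> real) \<Rightarrow> real" where
  "influence n i f = measure_pmf.prob (cube_pmf n) {x. f x \<noteq> f (flip i x)}"

text \<open>
  A vector field is a function \<open>V\<close> with \<open>V x i\<close> the \<open>i\<close>-th component at \<open>x\<close>; only its values
  for \<open>x \<in> cube n\<close> and \<open>i < n\<close> are ever used.
\<close>

definition divergence ::
    "nat \<Rightarrow> ((nat \<Rightarrow> real) \<Rightarrow> nat \<Rightarrow> real) \<Rightarrow> (nat \<Rightarrow> real) \<Rightarrow> real" where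
  "divergence n V x = (\<Sum>i<n. V x i - V (flip i x) i)"

text \<open>
  The set below is bounded below by 0 and is never empty (\<open>V x i = f x / 2\<close> is feasible), so
  the infimum in the reals is the genuine one.
\<close>

definition beckmann :: "nat \<Rightarrow> ((nat \<Rightarrow> real) \<Rightarrow> real) \<Rightarrow> real" where
  "beckmann n f =
     Inf {measure_pmf.expectation (cube_pmf n) (\<lambda>x. L2_set (V x) {..<n}) | V.
            \<forall>x\<in>cube n. divergence n V x = laplacian n f x}"

definition influence_sq_sum :: "nat \<Rightarrow> ((nat \<Rightarrow> real) \<Rightarrow> real) \<Rightarrow> real" where
  "influence_sq_sum n f = (\<Sum>i<n. (influence n i f)\<^sup>2)"

end

theory Submission
  imports Defs
begin

text \<open>
  Write \<open>P\<^sub>t\<close> for the heat semigroup on the cube, which multiplies the Fourier coefficient of \<open>f\<close> at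
  \<open>S\<close> by \<open>exp (- t |S|)\<close>, let \<open>Var\<close> be the variance of \<open>f\<close> and \<open>M\<close> the sum of its squared
  influences, and set \<open>W t = (\<Sum>S \<noteq> {}. exp (- t |S|) * (fcoeff n f S)\<^sup>2)\<close>, so that \<open>W 0 = Var\<close>. The proof
  bounds the decrease of \<open>W\<close> in two opposite directions.

  \<^bold>\<open>Transport limits the decrease.\<close> Let \<open>V\<close> be a vector field with divergence \<open>L f\<close> and let \<open>B\<close> be the
  average of its Euclidean norm. Summation by parts gives
  \<open>E[h * L f] \<le> 2 * B * sup |\<nabla>h|\<close> for every \<open>h\<close>. Take \<open>h = P\<^sub>t f\<close>. Since \<open>|f| \<le> 1\<close>, Bessel's
  inequality for the biased measure that defines \<open>P\<^sub>t f (x)\<close> yields the pointwise estimate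
  \<open>|\<nabla>P\<^sub>t f| \<le> 1 / sqrt (2 * t)\<close> (\<open>gradient_noise_bound\<close>). The left-hand side is \<open>- W' t\<close>, hence
  \<open>- W' t \<le> 2 * B / sqrt (2 * t)\<close>, and integration gives \<open>W 0 - W T \<le> 2 * B * sqrt (2 * T)\<close>
  (\<open>variance_decay_le_transport\<close>).

  \<^bold>\<open>Small influences force a decrease.\<close> Bonami's \<open>(2, 4)\<close> inequality bounds the discounted weight
  \<open>(\<Sum>S. 3 ^ (- |S|) * (fcoeff n g S)\<^sup>2)\<close> by \<open>\<parallel>g\<parallel>\<^sub>1 * \<parallel>g\<parallel>\<^sub>2\<close> (\<open>hypercontractive_L1_L2\<close>). Let \<open>Q\<close> be the
  discounted weight of \<open>f\<close> over the nonempty \<open>S\<close>. Applying the bound to the martingale differences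
  of \<open>f\<close>, whose \<open>L\<^sup>1\<close> norms are at most the influences, gives \<open>Q\<^sup>2 \<le> M * Var\<close>; applying it to
  \<open>f - E f\<close>, whose \<open>L\<^sup>1\<close> norm equals \<open>Var\<close>, gives \<open>Q \<le> Var * sqrt Var\<close>. The first estimate is weak
  when \<open>Var\<close> is small compared with \<open>M\<close>, the second when \<open>Var\<close> is of constant order; their geometric
  mean \<open>Q \<le> Var * M powr (1 / 4)\<close> is free of this trade-off (\<open>discounted_weight_le_influences\<close>).
  Interpolating between exponents \<open>0\<close> and \<open>ln 3\<close> turns it into \<open>W T \<le> Var / 2\<close> for a time \<open>T\<close> of order
  \<open>1 / ln (1 / M)\<close>.

  Together, \<open>Var / 2 \<le> 2 * B * sqrt (2 * T)\<close>, which is the theorem when \<open>0 < M \<le> 1 / 16\<close>. For larger \<open>M\<close> the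
  logarithm is bounded and \<open>T = ln 3\<close> suffices.
\<close>

section \<open>Averages and characters on the cube\<close>

definition avg :: "nat \<Rightarrow> ((nat \<Rightarrow> real) \<Rightarrow> real) \<Rightarrow> real" where
  "avg n g = (\<Sum>x\<in>cube n. g x) / 2 ^ n"

definition chi :: "nat set \<Rightarrow> (nat \<Rightarrow> real) \<Rightarrow> real" where
  "chi S x = (\<Prod>i\<in>S. x i)"

definition fcoeff :: "nat \<Rightarrow> ((nat \<Rightarrow> real) \<Rightarrow> real) \<Rightarrow> nat set \<Rightarrow> real" where
  "fcoeff n g S = avg n (\<lambda>x. g x * chi S x)"

lemma finite_cube [simp, intro]: "finite (cube n)"
  unfolding cube_def by (intro finite_PiE) auto

lemma card_cube: "card (cube n) = 2 ^ n"
  unfolding cube_def by (subst card_PiE) (auto simp: numeral_2_eq_2)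

lemma cube_nonempty [simp]: "cube n \<noteq> {}"
  using card_cube[of n] by auto

lemma cube_coord: "x \<in> cube n \<Longrightarrow> i < n \<Longrightarrow> x i = 1 \<or> x i = -1"
  unfolding cube_def by auto

lemma cube_coord_sq: "x \<in> cube n \<Longrightarrow> i < n \<Longrightarrow> x i * x i = 1"
  using cube_coord[of x n i] by auto

lemma flip_in_cube: "x \<in> cube n \<Longrightarrow> i < n \<Longrightarrow> flip i x \<in> cube n"
  unfolding cube_def flip_def by (force simp: PiE_iff extensional_def)

lemma flip_flip [simp]: "flip i (flip i x) = x"
  by (auto simp: flip_def)

lemma expectation_eq_avg: "measure_pmf.expectation (cube_pmf n) g = avg n g"
  unfolding avg_def by (subst integral_pmf_of_set) (auto simp: card_cube)

lemma avg_cong: "(\<And>x. x \<in> cube n \<Longrightarrow> g x = h x) \<Longrightarrow> avg n g = avg n h"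
  by (simp add: avg_def)

lemma avg_mono: "(\<And>x. x \<in> cube n \<Longrightarrow> g x \<le> h x) \<Longrightarrow> avg n g \<le> avg n h"
  unfolding avg_def by (intro divide_right_mono sum_mono) auto

lemma avg_nonneg: "(\<And>x. x \<in> cube n \<Longrightarrow> 0 \<le> g x) \<Longrightarrow> 0 \<le> avg n g"
  unfolding avg_def by (intro divide_nonneg_nonneg sum_nonneg) auto

lemma avg_const [simp]: "avg n (\<lambda>x. c) = c"
  by (simp add: avg_def card_cube)

lemma avg_add: "avg n (\<lambda>x. g x + h x) = avg n g + avg n h"
  by (simp add: avg_def sum.distrib add_divide_distrib)

lemma avg_diff: "avg n (\<lambda>x. g x - h x) = avg n g - avg n h"
  by (simp add: avg_def sum_subtractf diff_divide_distrib)

lemma avg_cmult: "avg n (\<lambda>x. c * g x) = c * avg n g"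
  by (simp add: avg_def sum_distrib_left)

lemma avg_sum: "avg n (\<lambda>x. \<Sum>i\<in>A. g i x) = (\<Sum>i\<in>A. avg n (g i))"
  unfolding avg_def by (simp add: sum_divide_distrib[symmetric] sum.swap[of _ A])

lemma avg_flip:
  assumes "i < n"
  shows "avg n (\<lambda>x. g (flip i x)) = avg n g"
proof -
  have "(\<Sum>x\<in>cube n. g (flip i x)) = (\<Sum>x\<in>cube n. g x)"
    by (rule sum.reindex_bij_witness[of _ "flip i" "flip i"]) (auto intro: flip_in_cube assms)
  thus ?thesis by (simp add: avg_def)
qed

lemma avg_Cauchy_Schwarz:
  "(avg n (\<lambda>x. g x * h x))\<^sup>2 \<le> avg n (\<lambda>x. (g x)\<^sup>2) * avg n (\<lambda>x. (h x)\<^sup>2)"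
proof -
  have "(\<Sum>x\<in>cube n. g x * h x)\<^sup>2 \<le> (\<Sum>x\<in>cube n. (g x)\<^sup>2) * (\<Sum>x\<in>cube n. (h x)\<^sup>2)"
    by (rule Cauchy_Schwarz_ineq_sum)
  thus ?thesis
    by (simp add: avg_def power_divide power2_eq_square divide_right_mono)
qed

lemma chi_flip: "finite S \<Longrightarrow> chi S (flip i x) = (if i \<in> S then - chi S x else chi S x)"
  by (auto simp: chi_def flip_def prod.remove intro!: prod.cong)

lemma chi_empty [simp]: "chi {} x = 1"
  by (simp add: chi_def)

lemma chi_singleton [simp]: "chi {i} x = x i"
  by (simp add: chi_def)

lemma chi_insert: "finite S \<Longrightarrow> i \<notin> S \<Longrightarrow> chi (insert i S) x = x i * chi S x"
  by (simp add: chi_def)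

lemma chi_sq: "x \<in> cube n \<Longrightarrow> S \<subseteq> {..<n} \<Longrightarrow> chi S x * chi S x = 1"
  unfolding chi_def prod.distrib[symmetric] by (intro prod.neutral) (auto simp: cube_coord_sq)

text \<open>Flipping a coordinate that lies in only one of the two sets changes the sign of the product
  of the characters, so its average equals its own negative.\<close>

lemma avg_chi_chi:
  assumes "S \<subseteq> {..<n}" "T \<subseteq> {..<n}"
  shows "avg n (\<lambda>x. chi S x * chi T x) = of_bool (S = T)"
proof (cases "S = T")
  case True
  have "avg n (\<lambda>x. chi S x * chi T x) = avg n (\<lambda>x. 1)"
    using True assms by (intro avg_cong) (simp add: chi_sq)
  thus ?thesis using True by simp
next
  case False
  then obtain i where i: "i \<in> S \<longleftrightarrow> i \<notin> T" by blast
  hence "i < n" using assms by auto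
  have fin: "finite S" "finite T" using assms finite_subset by auto
  have "avg n (\<lambda>x. chi S x * chi T x) = avg n (\<lambda>x. chi S (flip i x) * chi T (flip i x))"
    using avg_flip[OF \<open>i < n\<close>, of "\<lambda>x. chi S x * chi T x"] by simp
  also have "\<dots> = avg n (\<lambda>x. (-1) * (chi S x * chi T x))"
    using i by (intro avg_cong) (auto simp: chi_flip fin)
  also have "\<dots> = - avg n (\<lambda>x. chi S x * chi T x)"
    by (simp only: avg_cmult)
  finally show ?thesis using False by simp
qed

section \<open>The noise operator\<close>

text \<open>Every coordinate carries its own correlation \<open>\<rho> i\<close>. A constant correlation \<open>exp (- t)\<close> is the heat
  semigroup at time \<open>t\<close>, and correlations in \<open>{0, 1}\<close> are conditional expectations, so one positivity argument
  covers both.\<close>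
definition noise_kernel :: "nat \<Rightarrow> (nat \<Rightarrow> real) \<Rightarrow> (nat \<Rightarrow> real) \<Rightarrow> (nat \<Rightarrow> real) \<Rightarrow> real" where
  "noise_kernel n \<rho> x y = (\<Prod>i<n. (1 + \<rho> i * (x i * y i)) / 2)"

definition noise ::
    "nat \<Rightarrow> (nat \<Rightarrow> real) \<Rightarrow> ((nat \<Rightarrow> real) \<Rightarrow> real) \<Rightarrow> (nat \<Rightarrow> real) \<Rightarrow> real" where
  "noise n \<rho> g x = (\<Sum>y\<in>cube n. noise_kernel n \<rho> x y * g y)"

text \<open>Multiplying out the product over the coordinates shows that the characters diagonalise the
  noise operator.\<close>

lemma kernel_expansion:
  "noise_kernel n \<rho> x y = (\<Sum>S\<in>Pow {..<n}. prod \<rho> S * chi S x * chi S y) / 2 ^ n"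
proof -
  have "(\<Prod>i<n. 1 + \<rho> i * (x i * y i)) = (\<Prod>i<n. \<rho> i * (x i * y i) + 1)"
    by (simp add: add.commute)
  also have "\<dots> = (\<Sum>S\<in>Pow {..<n}. prod \<rho> S * chi S x * chi S y)"
    by (subst prod_add) (auto simp: chi_def prod.distrib mult_ac)
  finally show ?thesis by (simp add: noise_kernel_def prod_dividef)
qed

lemma noise_expansion:
  "noise n \<rho> g x = (\<Sum>S\<in>Pow {..<n}. prod \<rho> S * fcoeff n g S * chi S x)"
proof -
  have "noise n \<rho> g x =
      (\<Sum>y\<in>cube n. \<Sum>S\<in>Pow {..<n}. prod \<rho> S * chi S x * (g y * chi S y / 2 ^ n))"
    unfolding noise_def kernel_expansion
    by (intro sum.cong refl) (simp add: sum_distrib_left sum_distrib_right sum_divide_distrib mult_ac)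
  also have "\<dots> = (\<Sum>S\<in>Pow {..<n}. \<Sum>y\<in>cube n. prod \<rho> S * chi S x * (g y * chi S y / 2 ^ n))"
    by (rule sum.swap)
  also have "\<dots> = (\<Sum>S\<in>Pow {..<n}. prod \<rho> S * fcoeff n g S * chi S x)"
    unfolding sum_distrib_left[symmetric] sum_divide_distrib[symmetric]
    by (simp add: fcoeff_def avg_def mult_ac)
  finally show ?thesis .
qed

lemma kernel_nonneg:
  assumes "x \<in> cube n" "y \<in> cube n" "\<And>i. i < n \<Longrightarrow> \<bar>\<rho> i\<bar> \<le> 1"
  shows "0 \<le> noise_kernel n \<rho> x y"
  unfolding noise_kernel_def
proof (intro prod_nonneg)
  fix i assume "i \<in> {..<n}"
  hence "i < n" by simp
  thus "0 \<le> (1 + \<rho> i * (x i * y i)) / 2"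
    using assms(3)[of i] cube_coord[OF assms(1), of i] cube_coord[OF assms(2), of i] by auto
qed

lemma kernel_one:
  assumes "x \<in> cube n" "y \<in> cube n"
  shows "noise_kernel n (\<lambda>_. 1) x y = of_bool (x = y)"
proof (cases "x = y")
  case True
  thus ?thesis using assms by (auto simp: noise_kernel_def cube_coord_sq intro!: prod.neutral)
next
  case False
  then obtain i where "i < n" "x i \<noteq> y i"
    using assms unfolding cube_def by (metis PiE_ext lessThan_iff)
  hence "1 + 1 * (x i * y i) = 0"
    using cube_coord[OF assms(1)] cube_coord[OF assms(2)] by fastforce
  thus ?thesis using False \<open>i < n\<close> by (auto simp: noise_kernel_def intro!: bexI[of _ i])
qed

text \<open>At correlation 1 the kernel is the identity, so the expansion of the kernel contains the
  completeness of the characters.\<close>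

lemma fourier_inversion:
  assumes "x \<in> cube n"
  shows "g x = (\<Sum>S\<in>Pow {..<n}. fcoeff n g S * chi S x)"
proof -
  have "g x = noise n (\<lambda>_. 1) g x"
    using assms by (simp add: noise_def kernel_one of_bool_def if_distrib[where f="\<lambda>a. a * _"] cong: if_cong)
  thus ?thesis by (simp add: noise_expansion)
qed

lemma fcoeff_chi_sum:
  assumes "T \<subseteq> {..<n}"
  shows "fcoeff n (\<lambda>x. \<Sum>S\<in>Pow {..<n}. c S * chi S x) T = c T"
proof -
  have "fcoeff n (\<lambda>x. \<Sum>S\<in>Pow {..<n}. c S * chi S x) T
      = (\<Sum>S\<in>Pow {..<n}. c S * avg n (\<lambda>x. chi S x * chi T x))"
    unfolding fcoeff_def by (simp add: sum_distrib_right mult.assoc avg_sum avg_cmult)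
  also have "\<dots> = (\<Sum>S\<in>Pow {..<n}. c S * of_bool (S = T))"
    by (intro sum.cong refl) (simp add: avg_chi_chi assms)
  also have "\<dots> = c T" using assms by (simp add: of_bool_def if_distrib cong: if_cong)
  finally show ?thesis .
qed

lemma fcoeff_noise:
  "S \<subseteq> {..<n} \<Longrightarrow> fcoeff n (noise n \<rho> g) S = prod \<rho> S * fcoeff n g S"
  using fcoeff_chi_sum[of S n "\<lambda>S. prod \<rho> S * fcoeff n g S"] by (simp add: noise_expansion[abs_def])

lemma parseval: "avg n (\<lambda>x. g x * h x) = (\<Sum>S\<in>Pow {..<n}. fcoeff n g S * fcoeff n h S)"
proof -
  have "avg n (\<lambda>x. g x * h x) = avg n (\<lambda>x. \<Sum>S\<in>Pow {..<n}. fcoeff n g S * (h x * chi S x))"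
    by (intro avg_cong, subst fourier_inversion[of _ n g])
       (auto simp: sum_distrib_left sum_distrib_right mult_ac)
  thus ?thesis by (simp add: avg_sum avg_cmult fcoeff_def)
qed

lemma noise_chi: 
  assumes "S \<subseteq> {..<n}"
  shows "noise n \<rho> (chi S) x = prod \<rho> S * chi S x"
proof -
  have "noise n \<rho> (chi S) x = (\<Sum>T\<in>Pow {..<n}. prod \<rho> T * of_bool (S = T) * chi T x)"
    unfolding noise_expansion fcoeff_def by (intro sum.cong refl) (simp add: avg_chi_chi assms)
  also have "\<dots> = prod \<rho> S * chi S x"
    using assms by (simp add: of_bool_def if_distrib if_distribR cong: if_cong)
  finally show ?thesis .
qed

lemma sum_kernel: "(\<Sum>y\<in>cube n. noise_kernel n \<rho> x y) = 1"
  using noise_chi[of "{}" n \<rho> x] by (simp add: noise_def)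

lemma kernel_commute: "noise_kernel n \<rho> x y = noise_kernel n \<rho> y x"
  by (simp add: noise_kernel_def mult.commute)

text \<open>The kernel is nonnegative and symmetric with total mass 1, hence doubly stochastic.\<close>

lemma noise_L1_contraction:
  assumes "\<And>i. i < n \<Longrightarrow> \<bar>\<rho> i\<bar> \<le> 1"
  shows "avg n (\<lambda>x. \<bar>noise n \<rho> g x\<bar>) \<le> avg n (\<lambda>x. \<bar>g x\<bar>)"
proof -
  have "(\<Sum>x\<in>cube n. \<bar>noise n \<rho> g x\<bar>) \<le> (\<Sum>x\<in>cube n. \<Sum>y\<in>cube n. noise_kernel n \<rho> x y * \<bar>g y\<bar>)"
    unfolding noise_def
    by (intro sum_mono order.trans[OF sum_abs])
       (auto simp: abs_mult kernel_nonneg assms intro!: sum_mono)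
  also have "\<dots> = (\<Sum>y\<in>cube n. \<Sum>x\<in>cube n. noise_kernel n \<rho> y x * \<bar>g y\<bar>)"
    by (subst sum.swap) (simp add: kernel_commute)
  also have "\<dots> = (\<Sum>y\<in>cube n. \<bar>g y\<bar>)"
    by (simp add: sum_distrib_right[symmetric] sum_kernel)
  finally show ?thesis by (simp add: avg_def divide_right_mono)
qed

section \<open>Hypercontractivity\<close>

lemma avg_coord_mult_invariant:
  assumes "i < n" "\<And>x. x \<in> cube n \<Longrightarrow> G (flip i x) = G x"
  shows "avg n (\<lambda>x. x i * G x) = 0"
proof -
  have "avg n (\<lambda>x. x i * G x) = avg n (\<lambda>x. flip i x i * G (flip i x))"
    using avg_flip[OF assms(1), of "\<lambda>x. x i * G x"] by simp
  also have "\<dots> = avg n (\<lambda>x. (-1) * (x i * G x))"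
    using assms(2) by (intro avg_cong) (auto simp: flip_def)
  also have "\<dots> = - avg n (\<lambda>x. x i * G x)"
    by (simp only: avg_cmult)
  finally show ?thesis by simp
qed

text \<open>Bonami's lemma: noise of correlation \<open>1 / sqrt 3\<close> contracts \<open>L\<^sup>2\<close> into \<open>L\<^sup>4\<close>. Splitting off a coordinate
  writes the function as \<open>a + r * x\<^sub>i * b\<close> with \<open>a\<close> and \<open>b\<close> independent of \<open>x\<^sub>i\<close>. In the average of the fourth
  power the odd powers of \<open>x\<^sub>i\<close> vanish, the mixed term \<open>6 * r\<^sup>2 * a\<^sup>2 * b\<^sup>2\<close> is bounded by Cauchy-Schwarz and the
  induction hypothesis, and \<open>6 * r\<^sup>2 = 2\<close> is exactly the coefficient in \<open>(\<alpha> + \<beta>)\<^sup>2\<close>.\<close>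

lemma bonami:
  fixes r :: real
  assumes r: "r\<^sup>2 = 1 / 3" and "finite A" "A \<subseteq> {..<n}"
  shows "avg n (\<lambda>x. (\<Sum>S\<in>Pow A. r ^ card S * c S * chi S x) ^ 4) \<le> (\<Sum>S\<in>Pow A. (c S)\<^sup>2)\<^sup>2"
  using assms(2,3)
proof (induction A arbitrary: c)
  case empty
  thus ?case by (simp flip: power_mult)
next
  case (insert i A)
  have i: "i < n" and A: "A \<subseteq> {..<n}" using insert.prems by auto
  define a where "a = (\<lambda>x. \<Sum>S\<in>Pow A. r ^ card S * c S * chi S x)"
  define b where "b = (\<lambda>x. \<Sum>S\<in>Pow A. r ^ card S * c (insert i S) * chi S x)"
  define \<alpha> where "\<alpha> = (\<Sum>S\<in>Pow A. (c S)\<^sup>2)"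
  define \<beta> where "\<beta> = (\<Sum>S\<in>Pow A. (c (insert i S))\<^sup>2)"
  have nonneg: "\<alpha> \<ge> 0" "\<beta> \<ge> 0" by (auto simp: \<alpha>_def \<beta>_def intro: sum_nonneg)
  have fin: "finite S" and notin: "i \<notin> S" if "S \<in> Pow A" for S
    using that insert.hyps by (auto intro: finite_subset)
  have inj: "inj_on (insert i) (Pow A)"
    using insert.hyps by (auto simp: inj_on_def)
  have disj: "Pow A \<inter> insert i ` Pow A = {}" using insert.hyps by auto
  have split: "(\<Sum>S\<in>Pow (insert i A). F S) = (\<Sum>S\<in>Pow A. F S) + (\<Sum>S\<in>Pow A. F (insert i S))"
    for F :: "nat set \<Rightarrow> real"
    using insert.hyps disj inj
    by (simp add: Pow_insert sum.union_disjoint sum.reindex)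
  have decomp: "(\<Sum>S\<in>Pow (insert i A). r ^ card S * c S * chi S x) = a x + r * x i * b x" for x
    unfolding split a_def b_def sum_distrib_left using fin notin
    by (intro arg_cong2[where f="(+)"] refl sum.cong) (auto simp: chi_insert mult_ac)
  have inv: "a (flip i x) = a x" "b (flip i x) = b x" for x
    unfolding a_def b_def using fin notin by (auto simp: chi_flip intro!: sum.cong)
  have IHa: "avg n (\<lambda>x. a x ^ 4) \<le> \<alpha>\<^sup>2" and IHb: "avg n (\<lambda>x. b x ^ 4) \<le> \<beta>\<^sup>2"
    unfolding a_def b_def \<alpha>_def \<beta>_def
    using insert.IH[OF A, of c] insert.IH[OF A, of "\<lambda>S. c (insert i S)"] by blast+
  have nonneg': "0 \<le> avg n (\<lambda>x. a x ^ 4)" "0 \<le> avg n (\<lambda>x. b x ^ 4)"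
    by (auto intro: avg_nonneg)
  have cross: "avg n (\<lambda>x. (a x)\<^sup>2 * (b x)\<^sup>2) \<le> \<alpha> * \<beta>"
  proof (rule power2_le_imp_le)
    have "(avg n (\<lambda>x. (a x)\<^sup>2 * (b x)\<^sup>2))\<^sup>2 \<le> avg n (\<lambda>x. a x ^ 4) * avg n (\<lambda>x. b x ^ 4)"
      using avg_Cauchy_Schwarz[of n "\<lambda>x. (a x)\<^sup>2" "\<lambda>x. (b x)\<^sup>2"] by (simp flip: power_mult)
    also have "\<dots> \<le> \<alpha>\<^sup>2 * \<beta>\<^sup>2" using IHa IHb nonneg' by (intro mult_mono) auto
    finally show "(avg n (\<lambda>x. (a x)\<^sup>2 * (b x)\<^sup>2))\<^sup>2 \<le> (\<alpha> * \<beta>)\<^sup>2" by (simp add: power_mult_distrib)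
  qed (use nonneg in simp)
  have "r ^ 4 = (r\<^sup>2)\<^sup>2" by (simp flip: power_mult)
  hence r4: "r ^ 4 = 1 / 9" unfolding r by (simp add: power_divide)
  define G where "G = (\<lambda>x. 4 * r * (a x) ^ 3 * b x + 4 * r ^ 3 * a x * (b x) ^ 3)"
  have odd_part: "avg n (\<lambda>x. x i * G x) = 0"
    by (intro avg_coord_mult_invariant i) (simp add: G_def inv)
  have "avg n (\<lambda>x. (a x + r * x i * b x) ^ 4)
      = avg n (\<lambda>x. a x ^ 4 + 6 * r\<^sup>2 * ((a x)\<^sup>2 * (b x)\<^sup>2) + r ^ 4 * b x ^ 4 + x i * G x)"
  proof (rule avg_cong)
    fix x assume "x \<in> cube n"
    hence "x i = 1 \<or> x i = -1" using cube_coord i by blast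
    thus "(a x + r * x i * b x) ^ 4
        = a x ^ 4 + 6 * r\<^sup>2 * ((a x)\<^sup>2 * (b x)\<^sup>2) + r ^ 4 * b x ^ 4 + x i * G x"
      unfolding G_def
      by (elim disjE) (simp_all add: eval_nat_numeral algebra_simps)
  qed
  also have "\<dots> = avg n (\<lambda>x. a x ^ 4) + 2 * avg n (\<lambda>x. (a x)\<^sup>2 * (b x)\<^sup>2)
      + 1 / 9 * avg n (\<lambda>x. b x ^ 4)"
    by (simp only: avg_add avg_cmult odd_part r r4)
  also have "\<dots> \<le> \<alpha>\<^sup>2 + 2 * (\<alpha> * \<beta>) + 1 / 9 * \<beta>\<^sup>2"
    using IHa IHb cross by (intro add_mono mult_left_mono) auto
  also have "\<dots> \<le> (\<alpha> + \<beta>)\<^sup>2"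
    by (simp add: power2_sum)
  also have "\<alpha> + \<beta> = (\<Sum>S\<in>Pow (insert i A). (c S)\<^sup>2)"
    by (simp only: split \<alpha>_def \<beta>_def)
  finally show ?case by (simp only: decomp)
qed

text \<open>With \<open>h\<close> the function \<open>g\<close> after noise of correlation \<open>1 / 3\<close>, the left-hand side is \<open>Q = E[g * h]\<close>. As \<open>h\<close> arises
  by noise of correlation \<open>1 / sqrt 3\<close> from a function with squared \<open>L\<^sup>2\<close> norm \<open>Q\<close>, Bonami's lemma gives
  \<open>\<parallel>h\<parallel>\<^sub>4\<^sup>2 \<le> Q\<close>. Two applications of Cauchy-Schwarz, \<open>E[|g| * |h|]\<^sup>2 \<le> E|g| * E[|g| * h\<^sup>2]\<close> and
  \<open>E[|g| * h\<^sup>2] \<le> \<parallel>g\<parallel>\<^sub>2 * \<parallel>h\<parallel>\<^sub>4\<^sup>2\<close>, then give \<open>Q\<^sup>2 \<le> \<parallel>g\<parallel>\<^sub>1 * \<parallel>g\<parallel>\<^sub>2 * Q\<close>. This replaces duality and the interpolation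
  of the \<open>L\<close>-norm with exponent \<open>4 / 3\<close> between \<open>L\<^sup>1\<close> and \<open>L\<^sup>2\<close>.\<close>

lemma hypercontractive_L1_L2:
  "(\<Sum>S\<in>Pow {..<n}. (1 / 3) ^ card S * (fcoeff n g S)\<^sup>2)
    \<le> avg n (\<lambda>x. \<bar>g x\<bar>) * sqrt (avg n (\<lambda>x. (g x)\<^sup>2))"
proof -
  define Q where "Q = (\<Sum>S\<in>Pow {..<n}. (1 / 3) ^ card S * (fcoeff n g S)\<^sup>2)"
  define r :: real where "r = 1 / sqrt 3"
  have r: "r\<^sup>2 = 1 / 3" by (simp add: r_def power_divide)
  have r': "(1 / 3 :: real) ^ k = r ^ k * r ^ k" for k
    unfolding r[symmetric] by (simp add: power2_eq_square power_mult_distrib)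
  define h where "h = (\<lambda>x. \<Sum>S\<in>Pow {..<n}. ((1 / 3) ^ card S * fcoeff n g S) * chi S x)"
  have Q_nonneg: "Q \<ge> 0" unfolding Q_def by (intro sum_nonneg) auto
  have L1_nonneg: "0 \<le> avg n (\<lambda>x. \<bar>g x\<bar>)" by (intro avg_nonneg) auto
  have h4: "avg n (\<lambda>x. h x ^ 4) \<le> Q\<^sup>2"
    using bonami[OF r, of "{..<n}" n "\<lambda>S. r ^ card S * fcoeff n g S"]
    by (simp add: h_def Q_def r' power_mult_distrib mult_ac power2_eq_square)
  have Q_eq: "Q = avg n (\<lambda>x. g x * h x)"
    unfolding parseval h_def Q_def
    by (intro sum.cong refl, subst fcoeff_chi_sum) (auto simp: power2_eq_square)
  have gh2: "avg n (\<lambda>x. \<bar>g x\<bar> * (h x)\<^sup>2) \<le> sqrt (avg n (\<lambda>x. (g x)\<^sup>2)) * Q"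
  proof (rule power2_le_imp_le)
    have g2: "0 \<le> avg n (\<lambda>x. (g x)\<^sup>2)" by (intro avg_nonneg) auto
    have "(avg n (\<lambda>x. \<bar>g x\<bar> * (h x)\<^sup>2))\<^sup>2 \<le> avg n (\<lambda>x. (g x)\<^sup>2) * avg n (\<lambda>x. h x ^ 4)"
      using avg_Cauchy_Schwarz[of n "\<lambda>x. \<bar>g x\<bar>" "\<lambda>x. (h x)\<^sup>2"] by (simp flip: power_mult)
    also have "\<dots> \<le> avg n (\<lambda>x. (g x)\<^sup>2) * Q\<^sup>2"
      using h4 g2 by (intro mult_left_mono) auto
    finally show "(avg n (\<lambda>x. \<bar>g x\<bar> * (h x)\<^sup>2))\<^sup>2 \<le> (sqrt (avg n (\<lambda>x. (g x)\<^sup>2)) * Q)\<^sup>2"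
      using g2 by (simp add: power_mult_distrib)
  qed (use Q_nonneg in \<open>auto intro!: mult_nonneg_nonneg avg_nonneg\<close>)
  have "Q \<le> avg n (\<lambda>x. sqrt \<bar>g x\<bar> * (sqrt \<bar>g x\<bar> * \<bar>h x\<bar>))"
    unfolding Q_eq by (intro avg_mono) (simp flip: mult.assoc abs_mult)
  hence "Q\<^sup>2 \<le> (avg n (\<lambda>x. sqrt \<bar>g x\<bar> * (sqrt \<bar>g x\<bar> * \<bar>h x\<bar>)))\<^sup>2"
    using Q_nonneg by (intro power_mono) auto
  also have "\<dots> \<le> avg n (\<lambda>x. \<bar>g x\<bar>) * avg n (\<lambda>x. \<bar>g x\<bar> * (h x)\<^sup>2)"
    using avg_Cauchy_Schwarz[of n "\<lambda>x. sqrt \<bar>g x\<bar>" "\<lambda>x. sqrt \<bar>g x\<bar> * \<bar>h x\<bar>"]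
    by (simp add: power_mult_distrib)
  also have "\<dots> \<le> avg n (\<lambda>x. \<bar>g x\<bar>) * (sqrt (avg n (\<lambda>x. (g x)\<^sup>2)) * Q)"
    using gh2 L1_nonneg by (intro mult_left_mono)
  finally have *: "Q * Q \<le> (avg n (\<lambda>x. \<bar>g x\<bar>) * sqrt (avg n (\<lambda>x. (g x)\<^sup>2))) * Q"
    by (simp add: power2_eq_square mult_ac)
  have "Q \<le> avg n (\<lambda>x. \<bar>g x\<bar>) * sqrt (avg n (\<lambda>x. (g x)\<^sup>2))"
  proof (cases "Q = 0")
    case True
    thus ?thesis using L1_nonneg by (auto intro!: mult_nonneg_nonneg avg_nonneg)
  next
    case False
    thus ?thesis using * Q_nonneg by (simp add: mult_le_cancel_right)
  qed
  thus ?thesis by (simp add: Q_def)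
qed

section \<open>Spectral tail bounds from influences\<close>

lemma fcoeff_cube_deriv:
  assumes "i < n" "S \<subseteq> {..<n}"
  shows "fcoeff n (cube_deriv i g) S = of_bool (i \<in> S) * fcoeff n g S"
proof -
  have "finite S" using assms finite_subset by blast
  have "fcoeff n (cube_deriv i g) S
      = avg n (\<lambda>x. (1 / 2) * (g x * chi S x) - (1 / 2) * (g (flip i x) * chi S (flip i (flip i x))))"
    unfolding fcoeff_def cube_deriv_def by (intro avg_cong) (simp add: algebra_simps diff_divide_distrib)
  also have "\<dots> = 1 / 2 * fcoeff n g S - 1 / 2 * avg n (\<lambda>x. g (flip i x) * chi S (flip i (flip i x)))"
    unfolding fcoeff_def by (simp only: avg_diff avg_cmult)
  also have "avg n (\<lambda>x. g (flip i x) * chi S (flip i (flip i x))) = avg n (\<lambda>x. g x * chi S (flip i x))"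
    using avg_flip[OF assms(1), of "\<lambda>x. g x * chi S (flip i x)"] .
  also have "\<dots> = avg n (\<lambda>x. (if i \<in> S then -1 else 1) * (g x * chi S x))"
    by (intro avg_cong) (simp add: chi_flip \<open>finite S\<close>)
  also have "\<dots> = (if i \<in> S then -1 else 1) * fcoeff n g S"
    by (simp only: avg_cmult fcoeff_def)
  finally show ?thesis by simp
qed

lemma fcoeff_empty: "fcoeff n g {} = avg n g"
  by (simp add: fcoeff_def)

lemma fcoeff_centered:
  assumes "S \<subseteq> {..<n}"
  shows "fcoeff n (\<lambda>x. g x - avg n g) S = (if S = {} then 0 else fcoeff n g S)"
proof -
  have "fcoeff n (\<lambda>x. g x - avg n g) S
      = fcoeff n g S - avg n g * avg n (\<lambda>x. chi {} x * chi S x)"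
    by (simp add: fcoeff_def left_diff_distrib avg_diff avg_cmult)
  also have "\<dots> = fcoeff n g S - avg n g * of_bool (S = {})"
    using assms by (subst avg_chi_chi) auto
  finally show ?thesis by (auto simp: fcoeff_empty)
qed

lemma variance_spectral:
  "avg n (\<lambda>x. (g x - avg n g)\<^sup>2) = (\<Sum>S\<in>Pow {..<n} - {{}}. (fcoeff n g S)\<^sup>2)"
proof -
  have "avg n (\<lambda>x. (g x - avg n g)\<^sup>2) = (\<Sum>S\<in>Pow {..<n}. if S = {} then 0 else (fcoeff n g S)\<^sup>2)"
    unfolding power2_eq_square parseval
    by (intro sum.cong refl) (auto simp: fcoeff_centered)
  also have "\<dots> = (\<Sum>S\<in>Pow {..<n} - {{}}. (fcoeff n g S)\<^sup>2)"
    by (subst sum.remove[of _ "{}"]) (auto intro!: sum.cong)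
  finally show ?thesis .
qed

text \<open>The increment \<open>E[g | x\<^sub>0, \<dots>, x\<^sub>i] - E[g | x\<^sub>0, \<dots>, x\<^bsub>i-1\<^esub>]\<close> of the coordinate-exposure martingale. Written as
  the conditional expectation of \<open>cube_deriv i g\<close> given the first \<open>i + 1\<close> coordinates, it visibly has an
  \<open>L\<^sup>1\<close> norm at most that of the derivative.\<close>
definition martingale_diff ::
    "nat \<Rightarrow> ((nat \<Rightarrow> real) \<Rightarrow> real) \<Rightarrow> nat \<Rightarrow> (nat \<Rightarrow> real) \<Rightarrow> real" where
  "martingale_diff n g i = noise n (\<lambda>j. of_bool (j \<le> i)) (cube_deriv i g)"

lemma fcoeff_martingale_diff:
  assumes "i < n" "S \<subseteq> {..<n}"
  shows "fcoeff n (martingale_diff n g i) S = of_bool (i \<in> S \<and> S \<subseteq> {..i}) * fcoeff n g S"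
proof -
  have "finite S" using assms finite_subset by blast
  have "(\<Prod>j\<in>S. of_bool (j \<le> i)) = (of_bool (S \<subseteq> {..i}) :: real)"
  proof (cases "S \<subseteq> {..i}")
    case True
    thus ?thesis by (auto intro!: prod.neutral)
  next
    case False
    then obtain j where "j \<in> S" "\<not> j \<le> i" by auto
    thus ?thesis using False \<open>finite S\<close> by (auto simp: prod_zero_iff)
  qed
  thus ?thesis
    using assms by (auto simp: martingale_diff_def fcoeff_noise fcoeff_cube_deriv)
qed

text \<open>The increment with index \<open>i\<close> collects the frequencies with maximum \<open>i\<close>, so every nonempty
  frequency belongs to exactly one increment.\<close>

lemma sum_martingale_diff_spectrum:
  "(\<Sum>i<n. \<Sum>S\<in>Pow {..<n}. w S * (fcoeff n (martingale_diff n g i) S)\<^sup>2)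
    = (\<Sum>S\<in>Pow {..<n} - {{}}. w S * (fcoeff n g S)\<^sup>2)"
proof -
  have one_max: "(\<Sum>i<n. of_bool (i \<in> S \<and> S \<subseteq> {..i})) = (of_bool (S \<noteq> {}) :: real)"
    if "S \<in> Pow {..<n}" for S
  proof (cases "S = {}")
    case False
    have "finite S" using that finite_subset by blast
    have eq: "i \<in> S \<and> S \<subseteq> {..i} \<longleftrightarrow> i = Max S" for i
      using Max_in[OF \<open>finite S\<close> False] Max_ge[OF \<open>finite S\<close>]
      by (auto intro!: Max_eqI[symmetric] \<open>finite S\<close>)
    have "Max S < n" using that False \<open>finite S\<close> by auto
    thus ?thesis using False by (simp add: eq of_bool_def)
  qed simp
  have "(\<Sum>i<n. \<Sum>S\<in>Pow {..<n}. w S * (fcoeff n (martingale_diff n g i) S)\<^sup>2)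
      = (\<Sum>i<n. \<Sum>S\<in>Pow {..<n}. (w S * (fcoeff n g S)\<^sup>2) * of_bool (i \<in> S \<and> S \<subseteq> {..i}))"
    by (intro sum.cong refl) (auto simp: fcoeff_martingale_diff power_mult_distrib)
  also have "\<dots> = (\<Sum>S\<in>Pow {..<n}. (w S * (fcoeff n g S)\<^sup>2) * (\<Sum>i<n. of_bool (i \<in> S \<and> S \<subseteq> {..i})))"
    by (subst sum.swap) (simp only: sum_distrib_left)
  also have "\<dots> = (\<Sum>S\<in>Pow {..<n}. (w S * (fcoeff n g S)\<^sup>2) * of_bool (S \<noteq> {}))"
    by (intro sum.cong refl, subst one_max) auto
  also have "\<dots> = (\<Sum>S\<in>Pow {..<n} - {{}}. w S * (fcoeff n g S)\<^sup>2)"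
    by (subst sum.remove[of _ "{}"]) (auto intro!: sum.cong)
  finally show ?thesis .
qed

text \<open>Hypercontractivity is applied to each martingale increment separately; the squared \<open>L\<^sup>2\<close> norms of
  the increments add up to the variance and their \<open>L\<^sup>1\<close> norms are at most those of the derivatives.\<close>

lemma discounted_weight_le_L1_influences:
  "(\<Sum>S\<in>Pow {..<n} - {{}}. (1 / 3) ^ card S * (fcoeff n g S)\<^sup>2)\<^sup>2
    \<le> (\<Sum>i<n. (avg n (\<lambda>x. \<bar>cube_deriv i g x\<bar>))\<^sup>2) * avg n (\<lambda>x. (g x - avg n g)\<^sup>2)"
  (is "?Q\<^sup>2 \<le> ?M * ?V")
proof -
  define l1 where "l1 = (\<lambda>i. avg n (\<lambda>x. \<bar>martingale_diff n g i x\<bar>))"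
  define l2 where "l2 = (\<lambda>i. avg n (\<lambda>x. (martingale_diff n g i x)\<^sup>2))"
  have nonneg: "l1 i \<ge> 0" "l2 i \<ge> 0" for i
    unfolding l1_def l2_def by (auto intro: avg_nonneg)
  have "?Q = (\<Sum>i<n. \<Sum>S\<in>Pow {..<n}. (1 / 3) ^ card S * (fcoeff n (martingale_diff n g i) S)\<^sup>2)"
    by (rule sum_martingale_diff_spectrum[symmetric])
  also have "\<dots> \<le> (\<Sum>i<n. l1 i * sqrt (l2 i))"
    unfolding l1_def l2_def by (intro sum_mono hypercontractive_L1_L2)
  finally have "?Q\<^sup>2 \<le> (\<Sum>i<n. l1 i * sqrt (l2 i))\<^sup>2"
    by (intro power_mono sum_nonneg) auto
  also have "\<dots> \<le> (\<Sum>i<n. (l1 i)\<^sup>2) * (\<Sum>i<n. (sqrt (l2 i))\<^sup>2)"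
    by (rule Cauchy_Schwarz_ineq_sum)
  also have "(\<Sum>i<n. (sqrt (l2 i))\<^sup>2) = (\<Sum>i<n. \<Sum>S\<in>Pow {..<n}. 1 * (fcoeff n (martingale_diff n g i) S)\<^sup>2)"
    using nonneg by (simp add: l2_def) (simp add: power2_eq_square parseval)
  also have "\<dots> = ?V"
    unfolding sum_martingale_diff_spectrum variance_spectral by simp
  also have "(\<Sum>i<n. (l1 i)\<^sup>2) * ?V \<le> ?M * ?V"
    unfolding l1_def martingale_diff_def
    by (intro mult_right_mono sum_mono power_mono noise_L1_contraction avg_nonneg) auto
  finally show ?thesis .
qed

text \<open>For a sign-valued function with mean \<open>m\<close> one has \<open>|f - m| = 1 - m * f\<close>, so the \<open>L\<^sup>1\<close> norm of \<open>f - m\<close> and its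
  squared \<open>L\<^sup>2\<close> norm both equal \<open>1 - m\<^sup>2\<close>.\<close>

lemma discounted_weight_le_variance:
  assumes f: "f \<in> cube n \<rightarrow> {-1, 1}"
  defines "V \<equiv> avg n (\<lambda>x. (f x - avg n f)\<^sup>2)"
  shows "(\<Sum>S\<in>Pow {..<n} - {{}}. (1 / 3) ^ card S * (fcoeff n f S)\<^sup>2) \<le> V * sqrt V"
proof -
  define m where "m = avg n f"
  have val: "f x = -1 \<or> f x = 1" if "x \<in> cube n" for x using f that by auto
  have m: "-1 \<le> m" "m \<le> 1"
    using avg_mono[of n "\<lambda>_. -1" f] avg_mono[of n f "\<lambda>_. 1"] val unfolding m_def by force+
  have "V = avg n (\<lambda>x. (1 + m\<^sup>2) - (2 * m) * f x)"
    unfolding V_def m_def[symmetric]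
    by (intro avg_cong) (use val in \<open>force simp: power2_eq_square algebra_simps\<close>)
  also have "\<dots> = 1 - m\<^sup>2"
    by (simp only: avg_diff avg_cmult avg_const m_def[symmetric]) (simp add: power2_eq_square)
  finally have V: "V = 1 - m\<^sup>2" .
  have "avg n (\<lambda>x. \<bar>f x - m\<bar>) = avg n (\<lambda>x. 1 - m * f x)"
    by (intro avg_cong) (use val m in force)
  also have "\<dots> = V"
    by (simp only: avg_diff avg_cmult avg_const m_def[symmetric] V) (simp add: power2_eq_square)
  finally have L1: "avg n (\<lambda>x. \<bar>f x - m\<bar>) = V" .
  have "(\<Sum>S\<in>Pow {..<n} - {{}}. (1 / 3) ^ card S * (fcoeff n f S)\<^sup>2)
      = (\<Sum>S\<in>Pow {..<n}. (1 / 3) ^ card S * (fcoeff n (\<lambda>x. f x - m) S)\<^sup>2)"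
    unfolding m_def
    by (subst sum.remove[of "Pow {..<n}" "{}"]) (auto simp: fcoeff_centered intro!: sum.cong)
  also have "\<dots> \<le> avg n (\<lambda>x. \<bar>f x - m\<bar>) * sqrt (avg n (\<lambda>x. (f x - m)\<^sup>2))"
    by (rule hypercontractive_L1_L2)
  finally show ?thesis unfolding L1 by (simp add: V_def m_def)
qed

lemma influence_eq_avg_deriv:
  assumes f: "f \<in> cube n \<rightarrow> {-1, 1}" and "i < n"
  shows "influence n i f = avg n (\<lambda>x. \<bar>cube_deriv i f x\<bar>)"
proof -
  have "influence n i f = card (cube n \<inter> {x. f x \<noteq> f (flip i x)}) / card (cube n)"
    unfolding influence_def by (subst measure_pmf_of_set) auto
  also have "\<dots> = avg n (\<lambda>x. of_bool (f x \<noteq> f (flip i x)))"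
    by (simp add: avg_def card_cube of_bool_def sum.If_cases)
  also have "\<dots> = avg n (\<lambda>x. \<bar>cube_deriv i f x\<bar>)"
  proof (rule avg_cong)
    fix x assume "x \<in> cube n"
    hence "f x \<in> {-1, 1}" "f (flip i x) \<in> {-1, 1}" using f flip_in_cube[OF _ \<open>i < n\<close>] by auto
    thus "of_bool (f x \<noteq> f (flip i x)) = \<bar>cube_deriv i f x\<bar>"
      by (auto simp: cube_deriv_def)
  qed
  finally show ?thesis .
qed

text \<open>The geometric mean of the two preceding bounds: the product of \<open>Q\<^sup>2 \<le> M * Var\<close> and
  \<open>Q\<^sup>2 \<le> Var ^ 3\<close> is \<open>Q ^ 4 \<le> M * Var ^ 4\<close>. The last factor below is the fourth root of \<open>M\<close>.\<close>

lemma discounted_weight_le_influences: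
  assumes f: "f \<in> cube n \<rightarrow> {-1, 1}" and M: "influence_sq_sum n f > 0"
  shows "(\<Sum>S\<in>Pow {..<n} - {{}}. (1 / 3) ^ card S * (fcoeff n f S)\<^sup>2)
    \<le> avg n (\<lambda>x. (f x - avg n f)\<^sup>2) * exp (ln (influence_sq_sum n f) / 4)"
    (is "?Q \<le> ?V * _")
proof -
  define M where "M = influence_sq_sum n f"
  have "M > 0" using M by (simp add: M_def)
  have V: "?V \<ge> 0" by (intro avg_nonneg) auto
  have Q: "?Q \<ge> 0" by (intro sum_nonneg) auto
  have M_eq: "M = (\<Sum>i<n. (avg n (\<lambda>x. \<bar>cube_deriv i f x\<bar>))\<^sup>2)"
    unfolding M_def influence_sq_sum_def by (intro sum.cong refl) (simp add: influence_eq_avg_deriv[OF f])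
  have "?Q\<^sup>2 * ?Q\<^sup>2 \<le> (M * ?V) * (?V * sqrt ?V)\<^sup>2"
    using discounted_weight_le_L1_influences[of n f] discounted_weight_le_variance[OF f] Q V \<open>M > 0\<close>
    by (intro mult_mono power_mono) (auto simp: M_eq)
  hence "?Q ^ 4 \<le> ?V ^ 4 * M"
    using V by (simp add: power_mult_distrib mult_ac flip: power_add)
               (simp add: power2_eq_square power4_eq_xxxx mult_ac)
  also have "\<dots> = (?V * exp (ln M / 4)) ^ 4"
    using \<open>M > 0\<close> by (simp add: power_mult_distrib flip: exp_of_nat_mult)
  finally show ?thesis
    using V unfolding M_def by (intro power_le_imp_le_base[of ?Q 3]) (simp_all only: Suc_numeral semiring_norm exp_ge_zero mult_nonneg_nonneg)
qed

section \<open>Duality and the gradient of the heat flow\<close>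

text \<open>The easy half of linear programming duality for the Beckmann problem. Invariance of the average
  under flips moves the difference from \<open>V\<close> to \<open>h\<close>, and Cauchy-Schwarz applies at each point.\<close>

lemma avg_laplacian_le:
  assumes div: "\<forall>x\<in>cube n. divergence n V x = laplacian n f x"
    and grad: "\<And>x. x \<in> cube n \<Longrightarrow> L2_set (\<lambda>i. cube_deriv i h x) {..<n} \<le> G"
  shows "avg n (\<lambda>x. h x * laplacian n f x) \<le> 2 * G * avg n (\<lambda>x. L2_set (V x) {..<n})"
proof -
  have summand: "avg n (\<lambda>x. h x * (V x i - V (flip i x) i)) = avg n (\<lambda>x. 2 * (V x i * cube_deriv i h x))"
    if "i < n" for i
  proof -
    have "avg n (\<lambda>x. h x * V (flip i x) i) = avg n (\<lambda>x. h (flip i x) * V x i)"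
      using avg_flip[OF that, of "\<lambda>x. h (flip i x) * V x i"] by simp
    hence "avg n (\<lambda>x. h x * (V x i - V (flip i x) i))
        = avg n (\<lambda>x. h x * V x i - h (flip i x) * V x i)"
      by (simp add: right_diff_distrib avg_diff)
    also have "\<dots> = avg n (\<lambda>x. 2 * (V x i * cube_deriv i h x))"
      by (intro avg_cong) (simp add: cube_deriv_def field_simps)
    finally show ?thesis .
  qed
  have "avg n (\<lambda>x. h x * laplacian n f x) = avg n (\<lambda>x. \<Sum>i<n. h x * (V x i - V (flip i x) i))"
    using div by (intro avg_cong) (simp add: divergence_def flip: sum_distrib_left)
  also have "\<dots> = avg n (\<lambda>x. 2 * (\<Sum>i<n. V x i * cube_deriv i h x))"
    by (simp add: avg_sum summand avg_cmult sum_distrib_left)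
  also have "\<dots> \<le> avg n (\<lambda>x. 2 * G * L2_set (V x) {..<n})"
  proof (rule avg_mono)
    fix x assume x: "x \<in> cube n"
    have "(\<Sum>i<n. V x i * cube_deriv i h x) \<le> (\<Sum>i<n. \<bar>V x i\<bar> * \<bar>cube_deriv i h x\<bar>)"
      by (intro sum_mono) (simp flip: abs_mult)
    also have "\<dots> \<le> L2_set (V x) {..<n} * L2_set (\<lambda>i. cube_deriv i h x) {..<n}"
      by (rule L2_set_mult_ineq)
    also have "\<dots> \<le> L2_set (V x) {..<n} * G"
      by (intro mult_left_mono grad x L2_set_nonneg)
    finally show "2 * (\<Sum>i<n. V x i * cube_deriv i h x) \<le> 2 * G * L2_set (V x) {..<n}"
      by (simp add: mult_ac)
  qed
  finally show ?thesis by (simp add: avg_cmult)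
qed

text \<open>Under the probability weights \<open>noise_kernel n (\<lambda>_. \<rho>) x\<close> the signs \<open>x i * y i\<close> are independent with
  mean \<open>\<rho>\<close>; these are their covariances, read off from the action of the noise on characters.\<close>

lemma noise_kernel_moments:
  assumes "x \<in> cube n" "i < n" "j < n"
  shows "(\<Sum>y\<in>cube n. noise_kernel n (\<lambda>_. \<rho>) x y * ((x i * y i - \<rho>) * (x j * y j - \<rho>)))
    = (if i = j then 1 - \<rho>\<^sup>2 else 0)"
proof -
  let ?K = "noise_kernel n (\<lambda>_. \<rho>) x"
  have first: "(\<Sum>y\<in>cube n. ?K y * y k) = \<rho> * x k" if "k < n" for k
    using noise_chi[of "{k}" n "\<lambda>_. \<rho>" x] that by (simp add: noise_def)
  have second: "(\<Sum>y\<in>cube n. ?K y * (y i * y j)) * (x i * x j) = (if i = j then 1 else \<rho>\<^sup>2)"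
  proof (cases "i = j")
    case True
    have "(\<Sum>y\<in>cube n. ?K y * (y i * y j)) = (\<Sum>y\<in>cube n. ?K y)"
      using True assms by (intro sum.cong) (auto simp: cube_coord_sq)
    thus ?thesis using True assms by (simp add: sum_kernel cube_coord_sq)
  next
    case False
    have "(\<Sum>y\<in>cube n. ?K y * (y i * y j)) = \<rho>\<^sup>2 * (x i * x j)"
      using noise_chi[of "{i, j}" n "\<lambda>_. \<rho>" x] False assms
      by (simp add: noise_def chi_def power2_eq_square)
    hence "(\<Sum>y\<in>cube n. ?K y * (y i * y j)) * (x i * x j) = \<rho>\<^sup>2 * ((x i * x i) * (x j * x j))"
      by simp
    thus ?thesis using False assms by (simp add: cube_coord_sq)
  qed
  have "(\<Sum>y\<in>cube n. ?K y * ((x i * y i - \<rho>) * (x j * y j - \<rho>)))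
      = (\<Sum>y\<in>cube n. (?K y * (y i * y j)) * (x i * x j) - (\<rho> * x i) * (?K y * y i)
          - (\<rho> * x j) * (?K y * y j) + \<rho>\<^sup>2 * ?K y)"
    by (intro sum.cong refl) (simp add: power2_eq_square algebra_simps)
  also have "\<dots> = (\<Sum>y\<in>cube n. ?K y * (y i * y j)) * (x i * x j)
      - (\<rho> * x i) * (\<rho> * x i) - (\<rho> * x j) * (\<rho> * x j) + \<rho>\<^sup>2"
    by (simp add: sum.distrib sum_subtractf sum_kernel first assms
        flip: sum_distrib_left sum_distrib_right)
  also have "(\<rho> * x i) * (\<rho> * x i) = \<rho>\<^sup>2 * (x i * x i)" by (simp add: power2_eq_square)
  also have "(\<rho> * x j) * (\<rho> * x j) = \<rho>\<^sup>2 * (x j * x j)" by (simp add: power2_eq_square)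
  finally show ?thesis unfolding second using assms by (simp add: cube_coord_sq)
qed

text \<open>Integration by parts for the biased measure. Only the factor of the kernel with index \<open>i\<close> changes
  when \<open>x i\<close> is flipped, and \<open>(1 + \<rho> * s) * (s - \<rho>) = (1 - \<rho>\<^sup>2) * s\<close> for a sign \<open>s\<close>.\<close>

lemma cube_deriv_noise:
  assumes x: "x \<in> cube n" and i: "i < n" and \<rho>: "\<rho>\<^sup>2 \<noteq> 1"
  shows "cube_deriv i (noise n (\<lambda>_. \<rho>) g) x
    = \<rho> / (1 - \<rho>\<^sup>2) * (\<Sum>y\<in>cube n. noise_kernel n (\<lambda>_. \<rho>) x y * (x i * y i - \<rho>) * g y)"
proof -
  have point: "noise_kernel n (\<lambda>_. \<rho>) x y - noise_kernel n (\<lambda>_. \<rho>) (flip i x) y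
      = 2 * (\<rho> / (1 - \<rho>\<^sup>2) * (noise_kernel n (\<lambda>_. \<rho>) x y * (x i * y i - \<rho>)))"
    if y: "y \<in> cube n" for y
  proof -
    define R where "R = (\<Prod>j\<in>{..<n} - {i}. (1 + \<rho> * (x j * y j)) / 2)"
    define s where "s = x i * y i"
    have K: "noise_kernel n (\<lambda>_. \<rho>) x y = (1 + \<rho> * s) / 2 * R"
      unfolding noise_kernel_def R_def s_def using i by (subst prod.remove[of _ i]) auto
    have K': "noise_kernel n (\<lambda>_. \<rho>) (flip i x) y = (1 - \<rho> * s) / 2 * R"
      unfolding noise_kernel_def R_def s_def using i
      by (subst prod.remove[of _ i]) (auto simp: flip_def intro!: prod.cong)
    have "s = 1 \<or> s = -1"
      unfolding s_def using cube_coord[OF x i] cube_coord[OF y i] by auto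
    hence s2: "s * s = 1" by auto
    have "(1 + \<rho> * s) * (s - \<rho>) = s * (1 - \<rho>\<^sup>2) + \<rho> * (s * s - 1)"
      by (simp add: power2_eq_square algebra_simps)
    hence "(1 + \<rho> * s) * (s - \<rho>) / (1 - \<rho>\<^sup>2) = s"
      using \<rho> s2 by simp
    hence "\<rho> * R * ((1 + \<rho> * s) * (s - \<rho>) / (1 - \<rho>\<^sup>2)) = \<rho> * R * s" by simp
    thus ?thesis unfolding K K' s_def[symmetric]
      by (simp add: field_simps)
  qed
  have "cube_deriv i (noise n (\<lambda>_. \<rho>) g) x
      = (\<Sum>y\<in>cube n. (noise_kernel n (\<lambda>_. \<rho>) x y - noise_kernel n (\<lambda>_. \<rho>) (flip i x) y) / 2 * g y)"
    by (simp add: cube_deriv_def noise_def sum_subtractf left_diff_distrib diff_divide_distrib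
        sum_divide_distrib)
  also have "\<dots> = (\<Sum>y\<in>cube n. \<rho> / (1 - \<rho>\<^sup>2) * (noise_kernel n (\<lambda>_. \<rho>) x y * (x i * y i - \<rho>) * g y))"
    proof (intro sum.cong refl)
    fix y assume "y \<in> cube n"
    show "(noise_kernel n (\<lambda>_. \<rho>) x y - noise_kernel n (\<lambda>_. \<rho>) (flip i x) y) / 2 * g y
        = \<rho> / (1 - \<rho>\<^sup>2) * (noise_kernel n (\<lambda>_. \<rho>) x y * (x i * y i - \<rho>) * g y)"
      unfolding point[OF \<open>y \<in> cube n\<close>] by (simp only: mult_ac nonzero_mult_div_cancel_left)
  qed
  finally show ?thesis by (simp only: sum_distrib_left)
qed

text \<open>The partial derivatives at \<open>x\<close> are \<open>\<rho> / (1 - \<rho>\<^sup>2)\<close> times the inner products \<open>a i\<close> of \<open>g\<close> with the functions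
  \<open>\<phi> i y = x i * y i - \<rho>\<close>. These are orthogonal with squared norm \<open>1 - \<rho>\<^sup>2\<close> with respect to the kernel
  weights, so Bessel's inequality bounds the sum of the squares of the \<open>a i\<close> by \<open>1 - \<rho>\<^sup>2\<close>.\<close>

lemma gradient_noise_bound:
  assumes x: "x \<in> cube n" and \<rho>: "0 \<le> \<rho>" "\<rho> < 1"
    and g: "\<And>y. y \<in> cube n \<Longrightarrow> \<bar>g y\<bar> \<le> 1"
  shows "(\<Sum>i<n. (cube_deriv i (noise n (\<lambda>_. \<rho>) g) x)\<^sup>2) \<le> \<rho>\<^sup>2 / (1 - \<rho>\<^sup>2)"
proof -
  define K where "K = noise_kernel n (\<lambda>_. \<rho>) x"
  define \<phi> where "\<phi> = (\<lambda>i y. x i * y i - \<rho>)"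
  define a where "a = (\<lambda>i. \<Sum>y\<in>cube n. K y * \<phi> i y * g y)"
  define A where "A = (\<Sum>i<n. (a i)\<^sup>2)"
  have \<rho>2: "\<rho>\<^sup>2 < 1" using \<rho> by (simp add: power_less_one_iff)
  have K: "K y \<ge> 0" if "y \<in> cube n" for y
    unfolding K_def using x that \<rho> by (intro kernel_nonneg) auto
  have A_nonneg: "A \<ge> 0" unfolding A_def by (intro sum_nonneg) auto
  \<comment> \<open>Expressing \<open>A\<close> as a single inner product lets Cauchy-Schwarz give \<open>A\<^sup>2 \<le> (1 - \<rho>\<^sup>2) * A\<close>.\<close>
  have A_eq: "A = (\<Sum>y\<in>cube n. (sqrt (K y) * g y) * (sqrt (K y) * (\<Sum>i<n. a i * \<phi> i y)))"
  proof -
    have "A = (\<Sum>i<n. \<Sum>y\<in>cube n. a i * (K y * \<phi> i y * g y))"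
      unfolding A_def power2_eq_square sum_distrib_left[symmetric] a_def ..
    also have "\<dots> = (\<Sum>y\<in>cube n. \<Sum>i<n. a i * (K y * \<phi> i y * g y))"
      by (rule sum.swap)
    also have "\<dots> = (\<Sum>y\<in>cube n. (sqrt (K y) * sqrt (K y)) * g y * (\<Sum>i<n. a i * \<phi> i y))"
      by (intro sum.cong refl) (use K in \<open>simp add: sum_distrib_left mult_ac\<close>)
    finally show ?thesis by (simp only: mult_ac)
  qed
  have mass: "(\<Sum>y\<in>cube n. (sqrt (K y) * g y)\<^sup>2) \<le> 1"
  proof -
    have "(\<Sum>y\<in>cube n. (sqrt (K y) * g y)\<^sup>2) \<le> (\<Sum>y\<in>cube n. K y)"
    proof (rule sum_mono)
      fix y assume y: "y \<in> cube n"
      have "(g y)\<^sup>2 \<le> 1" using g[OF y] by (simp add: abs_square_le_1)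
      thus "(sqrt (K y) * g y)\<^sup>2 \<le> K y"
        using K[OF y] by (simp add: power_mult_distrib mult_left_le)
    qed
    thus ?thesis by (simp add: K_def sum_kernel)
  qed
  have "(\<Sum>y\<in>cube n. (sqrt (K y) * (\<Sum>i<n. a i * \<phi> i y))\<^sup>2)
      = (\<Sum>y\<in>cube n. \<Sum>i<n. \<Sum>j<n. a i * a j * (K y * (\<phi> i y * \<phi> j y)))"
    by (intro sum.cong refl)
       (use K in \<open>simp add: power_mult_distrib, simp add: power2_eq_square sum_product sum_distrib_left mult_ac\<close>)
  also have "\<dots> = (\<Sum>i<n. \<Sum>y\<in>cube n. \<Sum>j<n. a i * a j * (K y * (\<phi> i y * \<phi> j y)))"
    by (rule sum.swap)
  also have "\<dots> = (\<Sum>i<n. \<Sum>j<n. a i * a j * (\<Sum>y\<in>cube n. K y * (\<phi> i y * \<phi> j y)))"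
    unfolding sum_distrib_left by (intro sum.cong refl sum.swap)
  also have "\<dots> = (\<Sum>i<n. \<Sum>j<n. a i * a j * (if i = j then 1 - \<rho>\<^sup>2 else 0))"
    unfolding K_def \<phi>_def by (intro sum.cong refl) (simp add: noise_kernel_moments x)
  also have "\<dots> = (1 - \<rho>\<^sup>2) * A"
    by (simp add: A_def if_distrib power2_eq_square sum_distrib_left mult_ac cong: if_cong)
  finally have norm: "(\<Sum>y\<in>cube n. (sqrt (K y) * (\<Sum>i<n. a i * \<phi> i y))\<^sup>2) = (1 - \<rho>\<^sup>2) * A" .
  have "A\<^sup>2 \<le> (\<Sum>y\<in>cube n. (sqrt (K y) * g y)\<^sup>2) * ((1 - \<rho>\<^sup>2) * A)"
    unfolding norm[symmetric] by (subst A_eq) (rule Cauchy_Schwarz_ineq_sum)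
  also have "\<dots> \<le> 1 * ((1 - \<rho>\<^sup>2) * A)"
    using mass A_nonneg \<rho>2 by (intro mult_right_mono) auto
  finally have "A * A \<le> (1 - \<rho>\<^sup>2) * A" by (simp add: power2_eq_square)
  hence A_le: "A \<le> 1 - \<rho>\<^sup>2"
    using A_nonneg \<rho>2 by (cases "A = 0") (auto simp: mult_le_cancel_right)
  have "(\<Sum>i<n. (cube_deriv i (noise n (\<lambda>_. \<rho>) g) x)\<^sup>2) = (\<rho> / (1 - \<rho>\<^sup>2))\<^sup>2 * A"
  proof -
    have "cube_deriv i (noise n (\<lambda>_. \<rho>) g) x = \<rho> / (1 - \<rho>\<^sup>2) * a i" if "i < n" for i
      unfolding a_def K_def \<phi>_def using \<rho>2 that x by (intro cube_deriv_noise) auto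
    hence "(\<Sum>i<n. (cube_deriv i (noise n (\<lambda>_. \<rho>) g) x)\<^sup>2) = (\<Sum>i<n. (\<rho> / (1 - \<rho>\<^sup>2))\<^sup>2 * (a i)\<^sup>2)"
      by (intro sum.cong refl) (simp only: power_mult_distrib lessThan_iff)
    thus ?thesis by (simp only: A_def sum_distrib_left)
  qed
  also have "\<dots> \<le> (\<rho> / (1 - \<rho>\<^sup>2))\<^sup>2 * (1 - \<rho>\<^sup>2)"
    using A_le by (intro mult_left_mono) auto
  also have "\<dots> = \<rho>\<^sup>2 / (1 - \<rho>\<^sup>2)"
    using \<rho>2 by (simp add: power2_eq_square)
  finally show ?thesis .
qed

lemma fcoeff_laplacian:
  assumes "S \<subseteq> {..<n}"
  shows "fcoeff n (laplacian n f) S = card S * fcoeff n f S"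
proof -
  have "fcoeff n (laplacian n f) S = (\<Sum>i<n. fcoeff n (cube_deriv i f) S)"
    by (simp add: fcoeff_def laplacian_def sum_distrib_right avg_sum)
  also have "\<dots> = (\<Sum>i<n. of_bool (i \<in> S)) * fcoeff n f S"
    using assms by (simp add: fcoeff_cube_deriv sum_distrib_right)
  also have "(\<Sum>i<n. of_bool (i \<in> S) :: real) = card S"
    using assms by (simp add: of_bool_def sum.If_cases Int_absorb1)
  finally show ?thesis .
qed

text \<open>Duality with the test function \<open>P\<^sub>t f\<close>. The gradient bound at \<open>\<rho> = exp (- t)\<close> reads
  \<open>1 / sqrt (exp (2 * t) - 1)\<close>, and \<open>exp (2 * t) - 1 \<ge> 2 * t\<close>.\<close>

lemma dissipation_le_transport:
  fixes t :: real
  assumes div: "\<forall>x\<in>cube n. divergence n V x = laplacian n f x"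
    and f: "f \<in> cube n \<rightarrow> {-1, 1}" and "t > 0"
  shows "(\<Sum>S\<in>Pow {..<n} - {{}}. card S * exp (- t * card S) * (fcoeff n f S)\<^sup>2)
    \<le> 2 * avg n (\<lambda>x. L2_set (V x) {..<n}) / sqrt (2 * t)"
proof -
  define \<rho> where "\<rho> = exp (- t)"
  have \<rho>: "0 \<le> \<rho>" "\<rho> < 1" using \<open>t > 0\<close> by (auto simp: \<rho>_def)
  have \<rho>2: "\<rho>\<^sup>2 / (1 - \<rho>\<^sup>2) \<le> 1 / (2 * t)"
  proof -
    have "\<rho>\<^sup>2 * (exp (2 * t) - 1) = 1 - \<rho>\<^sup>2"
      by (simp add: \<rho>_def right_diff_distrib power2_eq_square flip: exp_add)
    moreover have "\<rho>\<^sup>2 * (2 * t) \<le> \<rho>\<^sup>2 * (exp (2 * t) - 1)"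
      using exp_ge_add_one_self[of "2 * t"] by (intro mult_left_mono) (auto simp del: exp_ge_add_one_self)
    moreover have "\<rho>\<^sup>2 < 1" using \<rho> by (simp add: power_less_one_iff)
    ultimately show ?thesis using \<open>t > 0\<close> by (simp add: field_simps)
  qed
  have "L2_set (\<lambda>i. cube_deriv i (noise n (\<lambda>_. \<rho>) f) x) {..<n} \<le> 1 / sqrt (2 * t)"
    if x: "x \<in> cube n" for x
  proof -
    have "(\<Sum>i<n. (cube_deriv i (noise n (\<lambda>_. \<rho>) f) x)\<^sup>2) \<le> 1 / (2 * t)"
      using f by (intro order.trans[OF gradient_noise_bound[OF x \<rho>] \<rho>2]) (force simp: Pi_iff)
    hence "L2_set (\<lambda>i. cube_deriv i (noise n (\<lambda>_. \<rho>) f) x) {..<n} \<le> sqrt (1 / (2 * t))"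
      unfolding L2_set_def by (rule real_sqrt_le_mono)
    thus ?thesis by (simp add: real_sqrt_divide)
  qed
  from avg_laplacian_le[OF div this]
  have "avg n (\<lambda>x. noise n (\<lambda>_. \<rho>) f x * laplacian n f x)
      \<le> 2 * avg n (\<lambda>x. L2_set (V x) {..<n}) / sqrt (2 * t)" by simp
  moreover have "avg n (\<lambda>x. noise n (\<lambda>_. \<rho>) f x * laplacian n f x)
      = (\<Sum>S\<in>Pow {..<n}. card S * exp (- t * card S) * (fcoeff n f S)\<^sup>2)"
    unfolding parseval
    by (intro sum.cong refl)
       (simp add: fcoeff_noise fcoeff_laplacian \<rho>_def power2_eq_square mult_ac flip: exp_of_nat_mult)
  moreover have "\<dots> = (\<Sum>S\<in>Pow {..<n} - {{}}. card S * exp (- t * card S) * (fcoeff n f S)\<^sup>2)"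
    by (subst sum.remove[of _ "{}"]) auto
  ultimately show ?thesis by simp
qed

text \<open>The dissipation bound integrated over \<open>{0..T}\<close>: adding \<open>2 * B * sqrt (2 * t)\<close>, a primitive of the
  bound, makes the weight nondecreasing in \<open>t\<close>. The primitive is not differentiable at 0, but continuity there
  is enough.\<close>

lemma variance_decay_le_transport:
  fixes T :: real
  assumes div: "\<forall>x\<in>cube n. divergence n V x = laplacian n f x"
    and f: "f \<in> cube n \<rightarrow> {-1, 1}" and "T \<ge> 0"
  shows "avg n (\<lambda>x. (f x - avg n f)\<^sup>2)
      - (\<Sum>S\<in>Pow {..<n} - {{}}. exp (- T * card S) * (fcoeff n f S)\<^sup>2)
    \<le> 2 * avg n (\<lambda>x. L2_set (V x) {..<n}) * sqrt (2 * T)"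
proof -
  define B where "B = avg n (\<lambda>x. L2_set (V x) {..<n})"
  define F where "F = (\<lambda>t::real. (\<Sum>S\<in>Pow {..<n} - {{}}. exp (- t * card S) * (fcoeff n f S)\<^sup>2)
    + 2 * B * sqrt (2 * t))"
  have "F 0 \<le> F T"
  proof (rule DERIV_nonneg_imp_increasing_open[OF \<open>T \<ge> 0\<close>])
    fix t :: real assume "0 < t"
    have "(F has_real_derivative
        (\<Sum>S\<in>Pow {..<n} - {{}}. - (card S * exp (- t * card S) * (fcoeff n f S)\<^sup>2))
        + 2 * B / sqrt (2 * t)) (at t)"
      unfolding F_def using \<open>0 < t\<close>
      by (auto intro!: derivative_eq_intros DERIV_sum simp: field_simps)
    moreover have "0 \<le> (\<Sum>S\<in>Pow {..<n} - {{}}. - (card S * exp (- t * card S) * (fcoeff n f S)\<^sup>2))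
        + 2 * B / sqrt (2 * t)"
      using dissipation_le_transport[OF div f \<open>0 < t\<close>] by (simp add: B_def sum_negf)
    ultimately show "\<exists>y. (F has_real_derivative y) (at t) \<and> y \<ge> 0" by blast
  next
    show "continuous_on {0..T} F" unfolding F_def by (intro continuous_intros)
  qed
  thus ?thesis by (simp add: F_def B_def variance_spectral)
qed

section \<open>The lower bound\<close>

text \<open>Interpolation between the undiscounted weight, which is the variance, and the weight discounted by
  \<open>3 ^ (- |S|)\<close>, which is at most \<open>exp (- l)\<close> times the variance. The time \<open>\<theta> * ln 3\<close> should gain a factor
  \<open>exp (- \<theta> * l)\<close>, and \<open>\<theta> = ln 2 / l\<close> makes this factor \<open>1 / 2\<close>. The condition \<open>M \<le> 1 / 16\<close>, with \<open>M\<close> the sum of squared influences, says that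
  \<open>\<theta> \<le> 1\<close>. Convexity of the exponential gives an inequality for each frequency that is linear in \<open>(1 / 3) ^ k\<close>, so
  it can be summed.\<close>

lemma discounted_weight_le_half_variance:
  assumes f: "f \<in> cube n \<rightarrow> {-1, 1}"
    and M: "0 < influence_sq_sum n f" "influence_sq_sum n f \<le> 1 / 16"
  defines "l \<equiv> - ln (influence_sq_sum n f) / 4"
  shows "(\<Sum>S\<in>Pow {..<n} - {{}}. exp (- (ln 2 * ln 3 / l) * card S) * (fcoeff n f S)\<^sup>2)
    \<le> avg n (\<lambda>x. (f x - avg n f)\<^sup>2) / 2"
proof -
  define V where "V = avg n (\<lambda>x. (f x - avg n f)\<^sup>2)"
  define Q where "Q = (\<Sum>S\<in>Pow {..<n} - {{}}. (1 / 3) ^ card S * (fcoeff n f S)\<^sup>2)"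
  define \<theta> where "\<theta> = ln 2 / l"
  have "ln (influence_sq_sum n f) \<le> ln (1 / 16)" using M by (subst ln_le_cancel_iff) auto
  also have "ln (1 / 16 :: real) = - 4 * ln 2"
    using ln_realpow[of "2 :: real" 4] by (simp add: ln_div)
  finally have l: "ln 2 \<le> l" by (simp add: l_def)
  have ln2: "ln (2 :: real) > 0" by simp
  have "l > 0" using l ln2 by linarith
  have \<theta>: "0 \<le> \<theta>" "\<theta> \<le> 1" "\<theta> * l = ln 2" using l ln2 \<open>l > 0\<close> by (auto simp: \<theta>_def)
  have Q: "Q \<le> V * exp (- l)"
    using discounted_weight_le_influences[OF f M(1)] by (simp add: Q_def V_def l_def)
  have term_bound: "exp (- (ln 2 * ln 3 / l) * k) \<le> 1 / 2 * (\<theta> * (exp l * (1 / 3) ^ k) + (1 - \<theta>))"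
    for k :: nat
  proof -
    have "exp (- (ln 2 * ln 3 / l) * k) = exp (- ln 2 + \<theta> * (l - k * ln 3))"
      unfolding right_diff_distrib \<theta>(3) by (simp add: \<theta>_def)
    also have "\<dots> = 1 / 2 * exp (\<theta> * (l - k * ln 3))"
      by (simp add: exp_add exp_minus exp_diff)
    also have "exp (\<theta> * (l - k * ln 3)) \<le> \<theta> * exp (l - k * ln 3) + (1 - \<theta>)"
      using convex_onD[OF exp_convex \<theta>(1,2), of 0 "l - k * ln 3"] by simp
    also have "exp (l - k * ln 3) = exp l * (1 / 3) ^ k"
      by (simp add: exp_diff exp_of_nat_mult power_one_over divide_simps)
    finally show ?thesis by simp
  qed
  have "(\<Sum>S\<in>Pow {..<n} - {{}}. exp (- (ln 2 * ln 3 / l) * card S) * (fcoeff n f S)\<^sup>2)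
      \<le> (\<Sum>S\<in>Pow {..<n} - {{}}.
          1 / 2 * (\<theta> * (exp l * (1 / 3) ^ card S) + (1 - \<theta>)) * (fcoeff n f S)\<^sup>2)"
    by (intro sum_mono mult_right_mono term_bound) auto
  also have "\<dots> = (\<Sum>S\<in>Pow {..<n} - {{}}. (1 / 2 * \<theta> * exp l) * ((1 / 3) ^ card S * (fcoeff n f S)\<^sup>2)
      + (1 / 2 * (1 - \<theta>)) * (fcoeff n f S)\<^sup>2)"
    by (intro sum.cong refl) (simp add: field_simps)
  also have "\<dots> = (1 / 2 * \<theta> * exp l) * Q + (1 / 2 * (1 - \<theta>)) * V"
    by (simp only: sum.distrib Q_def V_def variance_spectral sum_distrib_left)
  also have "\<dots> \<le> (1 / 2 * \<theta> * exp l) * (V * exp (- l)) + (1 / 2 * (1 - \<theta>)) * V"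
    using Q \<theta> by (intro add_right_mono mult_left_mono) auto
  also have "\<dots> = V / 2"
    by (simp add: exp_minus field_simps)
  finally show ?thesis by (simp add: V_def)
qed

text \<open>The factors \<open>sqrt (1 / l)\<close> from the time \<open>T\<close> and \<open>sqrt (8 * l)\<close> from the logarithm cancel. When \<open>M = 0\<close> the
  convention \<open>1 / 0 = 0\<close> makes the logarithm vanish.\<close>

lemma variance_log_le_transport:
  assumes div: "\<forall>x\<in>cube n. divergence n V x = laplacian n f x"
    and f: "f \<in> cube n \<rightarrow> {-1, 1}"
  shows "1 / 32 * avg n (\<lambda>x. (f x - avg n f)\<^sup>2) * sqrt (ln (1 + 1 / influence_sq_sum n f))
    \<le> avg n (\<lambda>x. L2_set (V x) {..<n})"
proof -
  define M where "M = influence_sq_sum n f"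
  define Var where "Var = avg n (\<lambda>x. (f x - avg n f)\<^sup>2)"
  define B where "B = avg n (\<lambda>x. L2_set (V x) {..<n})"
  have "M \<ge> 0" unfolding M_def influence_sq_sum_def by (intro sum_nonneg) auto
  have "Var \<ge> 0" unfolding Var_def by (intro avg_nonneg) auto
  have "B \<ge> 0" unfolding B_def by (intro avg_nonneg) auto
  have ln2: "0 < ln (2 :: real)" "ln (2 :: real) \<le> 1" using ln_le_minus_one[of "2 :: real"] by auto
  have ln3: "0 < ln (3 :: real)" "ln (3 :: real) \<le> 2" using ln_le_minus_one[of "3 :: real"] by auto
  note decay = variance_decay_le_transport[OF div f, folded Var_def B_def]
  consider "M = 0" | "0 < M" "M \<le> 1 / 16" | "M > 1 / 16" using \<open>M \<ge> 0\<close> by linarith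
  hence "Var * sqrt (ln (1 + 1 / M)) \<le> 32 * B"
  proof cases
    case 1
    thus ?thesis using \<open>B \<ge> 0\<close> by simp
  next
    case 2
    define l where "l = - ln M / 4"
    have "ln M \<le> ln (1 / 16)" using 2 by (subst ln_le_cancel_iff) auto
    also have "ln (1 / 16 :: real) < 0" by (simp add: ln_div)
    finally have "l > 0" by (simp add: l_def)
    have "Var - Var / 2 \<le> 2 * B * sqrt (2 * (ln 2 * ln 3 / l))"
    proof -
      have "0 \<le> ln 2 * ln 3 / l" using ln2 ln3 \<open>l > 0\<close> by simp
      from decay[OF this] discounted_weight_le_half_variance[OF f, folded M_def Var_def, OF 2]
      show ?thesis unfolding l_def by linarith
    qed
    hence Var: "Var \<le> 4 * B * sqrt (2 * (ln 2 * ln 3 / l))" by simp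
    have "1 + 1 / M \<le> (1 / M)\<^sup>2"
    proof -
      have "1 / M \<ge> 16" using 2 by (simp add: field_simps)
      hence "16 * (1 / M) \<le> 1 / M * (1 / M)" using 2 by (intro mult_right_mono) auto
      thus ?thesis using \<open>1 / M \<ge> 16\<close> unfolding power2_eq_square by linarith
    qed
    hence "ln (1 + 1 / M) \<le> ln ((1 / M)\<^sup>2)"
      using 2 by (subst ln_le_cancel_iff) (auto simp: add_pos_pos)
    also have "\<dots> = 8 * l" using 2 by (simp add: l_def ln_div ln_realpow)
    finally have ln_le: "ln (1 + 1 / M) \<le> 8 * l" .
    have "Var * sqrt (ln (1 + 1 / M)) \<le> (4 * B * sqrt (2 * (ln 2 * ln 3 / l))) * sqrt (8 * l)"
      using Var ln_le \<open>B \<ge> 0\<close> 2 ln2 ln3 \<open>l > 0\<close> by (intro mult_mono) auto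
    also have "\<dots> = 4 * B * sqrt (16 * (ln 2 * ln 3))"
      using \<open>l > 0\<close> by (simp flip: real_sqrt_mult)
    also have "\<dots> \<le> 4 * B * sqrt (8\<^sup>2)"
    proof (intro mult_left_mono real_sqrt_le_mono)
      have "ln 2 * ln 3 \<le> 1 * (2 :: real)" using ln2 ln3 by (intro mult_mono) auto
      thus "16 * (ln 2 * ln 3) \<le> (8 :: real)\<^sup>2" by simp
    qed (use \<open>B \<ge> 0\<close> in simp)
    finally show ?thesis by simp
  next
    case 3
    have "(\<Sum>S\<in>Pow {..<n} - {{}}. exp (- ln 3 * card S) * (fcoeff n f S)\<^sup>2)
        \<le> (\<Sum>S\<in>Pow {..<n} - {{}}. 1 / 3 * (fcoeff n f S)\<^sup>2)"
    proof (intro sum_mono mult_right_mono)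
      fix S assume S: "S \<in> Pow {..<n} - {{}}"
      hence "finite S" using finite_subset by blast
      hence "card S \<ge> 1" using S by (simp add: Suc_le_eq card_gt_0_iff)
      hence "exp (- ln 3 * card S) \<le> exp (- ln 3 :: real)" using ln3 by simp
      thus "exp (- ln 3 * card S) \<le> (1 / 3 :: real)" by (simp add: exp_minus)
    qed auto
    also have "\<dots> = Var / 3"
      unfolding Var_def variance_spectral by (simp add: sum_divide_distrib)
    finally have "Var - Var / 3 \<le> 2 * B * sqrt (2 * ln 3)"
      using decay[of "ln 3"] ln3 by simp
    also have "\<dots> \<le> 2 * B * sqrt (2\<^sup>2)"
      using ln3 \<open>B \<ge> 0\<close> by (intro mult_left_mono real_sqrt_le_mono) auto
    finally have Var: "Var \<le> 6 * B" by simp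
    have "ln (1 + 1 / M) \<le> (1 + 1 / M) - 1"
      using 3 by (intro ln_le_minus_one) (simp add: add_pos_pos)
    also have "\<dots> \<le> 4\<^sup>2" using 3 by (simp add: field_simps)
    finally have "sqrt (ln (1 + 1 / M)) \<le> 4" by (rule real_le_lsqrt[rotated -1]) auto
    hence "Var * sqrt (ln (1 + 1 / M)) \<le> (6 * B) * 4"
      using Var \<open>B \<ge> 0\<close> 3 by (intro mult_mono) auto
    thus ?thesis using \<open>B \<ge> 0\<close> by simp
  qed
  thus ?thesis by (simp add: M_def Var_def B_def)
qed

theorem theorem1p1:
  shows "\<exists>c::real. c > 0 \<and>
    (\<forall>(n::nat) (f :: (nat \<Rightarrow> real) \<Rightarrow> real).
       n \<ge> 1 \<longrightarrow> f \<in> cube n \<rightarrow> {-1, 1} \<longrightarrow> \<not> f constant_on cube n \<longrightarrow>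
       beckmann n f \<ge> c * measure_pmf.variance (cube_pmf n) f
                         * sqrt (ln (1 + 1 / influence_sq_sum n f)))"
proof (intro exI[of _ "1 / 32"] conjI allI impI)
  fix n :: nat and f :: "(nat \<Rightarrow> real) \<Rightarrow> real"
  assume f: "f \<in> cube n \<rightarrow> {-1, 1}"
  \<comment> \<open>An infimum over an empty set of reals would be unspecified, so a feasible field is needed.\<close>
  have "divergence n (\<lambda>x i. f x / 2) x = laplacian n f x" for x
    by (simp add: divergence_def laplacian_def cube_deriv_def diff_divide_distrib)
  hence feasible: "\<exists>V. \<forall>x\<in>cube n. divergence n V x = laplacian n f x" by blast
  show "beckmann n f \<ge> 1 / 32 * measure_pmf.variance (cube_pmf n) f
      * sqrt (ln (1 + 1 / influence_sq_sum n f))"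
    unfolding beckmann_def expectation_eq_avg
  proof (rule cInf_greatest)
    show "{avg n (\<lambda>x. L2_set (V x) {..<n}) |V.
        \<forall>x\<in>cube n. divergence n V x = laplacian n f x} \<noteq> {}"
      using feasible by blast
  qed (use variance_log_le_transport f in blast)
qed simp

end
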